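(* (Weak disadvantage of prominence with observable prices.) Let $s\in[\tfrac1{50},\tfrac18)$, $a=1-\sqrt{2s}\in(\tfrac12,\tfrac45]$. For $r\in[0,1-a]$ let $\pi_1^*,\pi_2^*$ be the equilibrium profits of the prominent firm (Firm 1) and the non-prominent firm (Firm 2). Then over $r\in[0,\hat r(a)]$, the profit advantage $\pi_1^*-\pi_2^*$ of the prominent firm strictly decreases as $r$ increases. Here $\hat r(a)$ is the threshold up to which the equilibrium prices decrease in $r$, i.e. the supremum of all $\rho\in[0,1-a]$ such that $p_1^*$ and $p_2^*$ are both strictly decreasing in $r$ on $[0,\rho]$.
   Context: Two firms sell one product each at zero marginal cost. Consumers (unit mass) have match values $u_1,u_2$, i.i.d. uniform on $[0,1]$. Firm 1 is prominent (searched and bought first, at no search cost); searching and buying product 2 costs $s$; returned units are fully refunded and cost the firm $r$ each. Both prices are observable before searching, so a consumer buys product 2 iff $u_1<a+p_1-p_2$. With $$d_1^n=1-a+p_2-p_1,\quad k_1=\tfrac12(a^2-p_2^2),\quad d_2^r=(a-p_2+p_1)(1-a),\quad k_2=\tfrac{a^2-p_2^2}{2}+(p_1-p_2)(a-p_2),$$ the profits are $$\pi_1(p_1,p_2)=(p_1+r)(d_1^n+k_1)-r,\qquad \pi_2(p_1,p_2)=(p_2+r)(d_2^r+k_2)-r(1-d_1^n).$$ An equilibrium is a pair $(p_1^*,p_2^* )$ such that $p_1^*$ maximizes $\pi_1(\cdot,p_2^* )$ over $p_1\ge0$ and $p_2^*$ maximizes $\pi_2(p_1^*,\cdot)$ over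 $p_2\in[0,a]$. For $r\in[0,1-a]$ the paper shows that the equilibrium exists and is unique; $\pi_i^*=\pi_i(p_1^*,p_2^* )$. The paper also shows that $(1-a)^2<\hat r(a)<3-2\sqrt{-a^2+2a+1}$. *)

theory Defs
  imports Complex_Main
begin

text \<open>
  Parameters: \<open>a\<close> is the reservation value \<open>1 - sqrt (2 * s)\<close> for search cost \<open>s\<close>, and \<open>r\<close> is
  the cost of a returned unit to its seller. Firm 1 is prominent; \<open>p1\<close>, \<open>p2\<close> are the prices.
\<close>

definition demand1_no_search :: "real \<Rightarrow> real \<Rightarrow> real \<Rightarrow> real" where
  "demand1_no_search a p1 p2 = 1 - a + p2 - p1"

definition demand1_return :: "real \<Rightarrow> real \<Rightarrow> real" where
  "demand1_return a p2 = (a\<^sup>2 - p2\<^sup>2) / 2"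

definition demand2_fresh :: "real \<Rightarrow> real \<Rightarrow> real \<Rightarrow> real" where
  "demand2_fresh a p1 p2 = (a - p2 + p1) * (1 - a)"

definition demand2_comparison :: "real \<Rightarrow> real \<Rightarrow> real \<Rightarrow> real" where
  "demand2_comparison a p1 p2 = (a\<^sup>2 - p2\<^sup>2) / 2 + (p1 - p2) * (a - p2)"

definition profit1 :: "real \<Rightarrow> real \<Rightarrow> real \<Rightarrow> real \<Rightarrow> real" where
  "profit1 a r p1 p2 = (p1 + r) * (demand1_no_search a p1 p2 + demand1_return a p2) - r"

definition profit2 :: "real \<Rightarrow> real \<Rightarrow> real \<Rightarrow> real \<Rightarrow> real" where
  "profit2 a r p1 p2 =
     (p2 + r) * (demand2_fresh a p1 p2 + demand2_comparison a p1 p2)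
       - r * (1 - demand1_no_search a p1 p2)"

definition is_equilibrium :: "real \<Rightarrow> real \<Rightarrow> real \<times> real \<Rightarrow> bool" where
  "is_equilibrium a r = (\<lambda>(p1, p2).
     is_arg_max (\<lambda>q. profit1 a r q p2) (\<lambda>q. 0 \<le> q) p1 \<and>
     is_arg_max (\<lambda>q. profit2 a r p1 q) (\<lambda>q. q \<in> {0..a}) p2)"

text \<open>
  The description is meant for \<open>1/2 < a \<le> 4/5\<close> and \<open>0 \<le> r \<le> 1 - a\<close>, where there is exactly one
  equilibrium; the notions below use it for such \<open>r\<close> only.
\<close>

definition equilibrium :: "real \<Rightarrow> real \<Rightarrow> real \<times> real" where
  "equilibrium a r = (THE p. is_equilibrium a r p)"

definition price1_eq :: "real \<Rightarrow> real \<Rightarrow> real" where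
  "price1_eq a r = fst (equilibrium a r)"

definition price2_eq :: "real \<Rightarrow> real \<Rightarrow> real" where
  "price2_eq a r = snd (equilibrium a r)"

definition profit1_eq :: "real \<Rightarrow> real \<Rightarrow> real" where
  "profit1_eq a r = profit1 a r (price1_eq a r) (price2_eq a r)"

definition profit2_eq :: "real \<Rightarrow> real \<Rightarrow> real" where
  "profit2_eq a r = profit2 a r (price1_eq a r) (price2_eq a r)"

text \<open>
  For \<open>a < 1\<close> the set below contains \<open>0\<close> and is bounded above by \<open>1 - a\<close>, so its supremum is
  a genuine least upper bound.
\<close>

definition r_hat :: "real \<Rightarrow> real" where
  "r_hat a = Sup {\<rho> \<in> {0..1 - a}.
     strict_antimono_on {0..\<rho>} (price1_eq a) \<and> strict_antimono_on {0..\<rho>} (price2_eq a)}"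

end

theory Submission imports Defs begin

text \<open>
  Firm 1's best reply is linear in the return cost, and substituting it into Firm 2's first-order
  condition leaves a cubic in \<open>p2\<close> that is increasing on \<open>[0, a]\<close>; its root is the equilibrium price.
  For \<open>r1 < r2 \<le> r_hat a\<close> with equilibria \<open>(x1, y1)\<close> and \<open>(x2, y2)\<close> we have \<open>y2 \<le> y1\<close>. Passing
  from \<open>(x2, y2)\<close> to \<open>(x', y1)\<close>, where \<open>x'\<close> is the best reply to \<open>y1\<close> at cost \<open>r2\<close>, does not lower
  the advantage of Firm 1: Firm 2 deviates from its optimum, and the higher price \<open>x'\<close> benefits
  Firm 1 by more than Firm 2. With \<open>y1\<close> fixed, lowering the return cost from \<open>r2\<close> to \<open>r1\<close> strictly
  raises the advantage, because \<open>y1\<close> is at most the equilibrium price at \<open>r = 0\<close>, which is below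
  \<open>0.41\<close>.
\<close>

section \<open>Best-reply formula and polynomial identities for the profits\<close>

definition reply1 :: "real \<Rightarrow> real \<Rightarrow> real \<Rightarrow> real" where
  "reply1 a r y = (1 - a + y + (a\<^sup>2 - y\<^sup>2) / 2 - r) / 2"

text \<open>Minus the derivative of \<open>profit2 a r x\<close> at \<open>y\<close>.\<close>

definition slope2 :: "real \<Rightarrow> real \<Rightarrow> real \<Rightarrow> real \<Rightarrow> real" where
  "slope2 a r x y = 2 * y - x + 2 * x * y - 3 / 2 * y\<^sup>2 + r * (x - y) - a + a\<^sup>2 / 2"

definition reduced_foc :: "real \<Rightarrow> real \<Rightarrow> real \<Rightarrow> real" where
  "reduced_foc a r y = slope2 a r (reply1 a r y) y"

lemma profit1_eq_max_minus_square:
  "profit1 a r q y = (reply1 a r y + r)\<^sup>2 - r - (q - reply1 a r y)\<^sup>2"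
  unfolding profit1_def demand1_no_search_def demand1_return_def reply1_def
  by (simp add: field_simps power2_eq_square)

lemma profit1_reply1: "profit1 a r (reply1 a r y) y = (reply1 a r y + r)\<^sup>2 - r"
  by (simp add: profit1_eq_max_minus_square)

text \<open>Exact Taylor expansion at \<open>y\<close> of a cubic in Firm 2's own price;
  \<open>2 + 2 * x - 3 * y - r\<close> is the derivative of \<open>slope2 a r x\<close> at
  \<open>y\<close>.\<close>

lemma profit2_diff:
  "profit2 a r x y - profit2 a r x q =
     slope2 a r x y * (q - y) + (q - y)\<^sup>2 / 2 * (2 + 2 * x - 3 * y - r - (q - y))"
  unfolding profit2_def demand1_no_search_def demand2_fresh_def demand2_comparison_def slope2_def
  by (simp add: field_simps power2_eq_square power3_eq_cube)

lemma slope2_taylor: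
  "slope2 a r x q = slope2 a r x y + (2 + 2 * x - 3 * y - r) * (q - y) - 3 / 2 * (q - y)\<^sup>2"
  unfolding slope2_def by (simp add: field_simps power2_eq_square)

lemma profit2_diff_price1:
  "profit2 a r x y - profit2 a r z y = (x - z) * (y * (1 - y - r))"
  unfolding profit2_def demand1_no_search_def demand2_fresh_def demand2_comparison_def
  by (simp add: field_simps power2_eq_square)

lemma is_arg_max_unique:
  fixes f :: "'a \<Rightarrow> real"
  assumes "P x" and "\<And>q. P q \<Longrightarrow> q \<noteq> x \<Longrightarrow> f q < f x"
  shows "is_arg_max f P z \<longleftrightarrow> z = x"
  using assms unfolding is_arg_max_def by (metis order_less_asym)

section \<open>Best replies of the two firms\<close>

locale market =
  fixes a :: real
  assumes a_gt: "1 / 2 < a" and a_le: "a \<le> 4 / 5"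
begin

lemma reply1_pos:
  assumes "r \<le> 1 - a" "0 \<le> y" "y \<le> a"
  shows "0 < reply1 a r y"
proof -
  have "y\<^sup>2 \<le> a\<^sup>2"
    using assms by (simp add: power_mono)
  moreover have "0 < y + (a\<^sup>2 - y\<^sup>2) / 2"
  proof (cases "y = 0")
    case True
    then show ?thesis using a_gt by simp
  next
    case False
    then have "0 < y"
      using assms by simp
    moreover have "0 \<le> (a\<^sup>2 - y\<^sup>2) / 2"
      using \<open>y\<^sup>2 \<le> a\<^sup>2\<close> by simp
    ultimately show ?thesis
      by (rule add_pos_nonneg)
  qed
  ultimately show ?thesis
    using assms unfolding reply1_def by simp
qed

lemma is_arg_max_profit1:
  assumes "r \<le> 1 - a" "0 \<le> y" "y \<le> a"
  shows "is_arg_max (\<lambda>q. profit1 a r q y) (\<lambda>q. 0 \<le> q) x \<longleftrightarrow> x = reply1 a r y"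
  using reply1_pos[OF assms]
  by (intro is_arg_max_unique) (auto simp: profit1_eq_max_minus_square)

lemma slope2_at_a_pos:
  assumes "0 \<le> r" "r \<le> 1 - a" "0 < x"
  shows "0 < slope2 a r x a"
proof -
  have "slope2 a r x a = a * (1 - a - r) + x * (2 * a - 1) + r * x"
    unfolding slope2_def by (simp add: field_simps power2_eq_square)
  moreover have "0 < x * (2 * a - 1)" "0 \<le> a * (1 - a - r)" "0 \<le> r * x"
    using assms a_gt by simp_all
  ultimately show ?thesis by linarith
qed

lemma slope2_at_0_neg:
  assumes "0 \<le> r" "r \<le> 1 - a" "0 < x"
  shows "slope2 a r x 0 < 0"
proof -
  have "slope2 a r x 0 = - (x * (1 - r)) - a * (1 - a / 2)"
    unfolding slope2_def by (simp add: field_simps power2_eq_square)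
  moreover have "0 \<le> x * (1 - r)" "0 < a * (1 - a / 2)"
    using assms a_gt a_le by simp_all
  ultimately show ?thesis by linarith
qed

text \<open>The comparison is global and does not go through concavity: positivity of
  \<open>slope2\<close> at \<open>a\<close> forces \<open>3 / 2 * (a - y) < ?k\<close>, which makes
  the remainder in \<open>profit2_diff\<close> positive for every admissible
  \<open>q\<close>.\<close>

lemma profit2_less_of_slope2_eq_0:
  assumes r: "0 \<le> r" "r \<le> 1 - a" and x: "0 < x" and y: "0 \<le> y" "y \<le> a"
    and foc: "slope2 a r x y = 0" and q: "0 \<le> q" "q \<le> a" "q \<noteq> y"
  shows "profit2 a r x q < profit2 a r x y"
proof -
  let ?k = "2 + 2 * x - 3 * y - r"
  have pos: "0 < slope2 a r x a"
    using slope2_at_a_pos r x by blast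
  then have "y < a"
    using y foc by (cases "y = a") auto
  have "?k * (a - y) - 3 / 2 * (a - y)\<^sup>2 = (?k - 3 / 2 * (a - y)) * (a - y)"
    by (simp add: power2_eq_square left_diff_distrib)
  then have "0 < (?k - 3 / 2 * (a - y)) * (a - y)"
    using pos slope2_taylor[of a r x a y] foc by linarith
  then have "3 / 2 * (a - y) < ?k"
    using \<open>y < a\<close> by (simp add: zero_less_mult_iff)
  then have "0 < ?k - (q - y)"
    using q \<open>y < a\<close> by (simp add: field_simps)
  then have "0 < (q - y)\<^sup>2 / 2 * (?k - (q - y))"
    using q by simp
  then show ?thesis
    using profit2_diff[of a r x y q] foc by simp
qed

lemma is_arg_max_profit2:
  assumes r: "0 \<le> r" "r \<le> 1 - a" and x: "0 < x"
  shows "is_arg_max (\<lambda>q. profit2 a r x q) (\<lambda>q. q \<in> {0..a}) y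
     \<longleftrightarrow> y \<in> {0..a} \<and> slope2 a r x y = 0"
proof -
  have "\<exists>z\<ge>0. z \<le> a \<and> slope2 a r x z = 0"
  proof (rule IVT')
    show "continuous_on {0..a} (slope2 a r x)"
      unfolding slope2_def by (intro continuous_intros)
  qed (use slope2_at_0_neg[OF assms] slope2_at_a_pos[OF assms] a_gt in auto)
  then obtain z where z: "0 \<le> z" "z \<le> a" "slope2 a r x z = 0"
    by blast
  have "is_arg_max (\<lambda>q. profit2 a r x q) (\<lambda>q. q \<in> {0..a}) y \<longleftrightarrow> y = z"
    using z profit2_less_of_slope2_eq_0[OF r x z] by (intro is_arg_max_unique) auto
  also have "\<dots> \<longleftrightarrow> y \<in> {0..a} \<and> slope2 a r x y = 0"
    \<comment> \<open>Each zero in the interval is a strict maximiser, and two of them would have to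
      beat each other.\<close>
    using z profit2_less_of_slope2_eq_0[OF r x] by (metis atLeastAtMost_iff order_less_asym)
  finally show ?thesis .
qed

section \<open>Existence and uniqueness of the equilibrium\<close>

lemma is_equilibrium_iff:
  assumes "0 \<le> r" "r \<le> 1 - a"
  shows "is_equilibrium a r (x, y)
     \<longleftrightarrow> x = reply1 a r y \<and> y \<in> {0..a} \<and> reduced_foc a r y = 0"
proof (cases "y \<in> {0..a}")
  case True
  then have "0 < reply1 a r y"
    using assms reply1_pos by simp
  then show ?thesis
    using True assms is_arg_max_profit1[of r y x] is_arg_max_profit2[of r "reply1 a r y" y]
    unfolding is_equilibrium_def reduced_foc_def by auto
next
  case False
  then show ?thesis
    unfolding is_equilibrium_def is_arg_max_def by auto
qed

lemma reduced_foc_strict_mono: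
  assumes r: "0 \<le> r" "r \<le> 1 - a" and yz: "0 \<le> y" "y < z" "z \<le> a"
  shows "reduced_foc a r y < reduced_foc a r z"
proof -
  \<comment> \<open>Twice the divided difference of the cubic. The bounds below reduce its
    positivity to that of \<open>2 - a - a\<^sup>2\<close>.\<close>
  let ?d = "5 - 2 * a + a\<^sup>2 - 3 * r - (1 + r) * (z + y) / 2 - (z\<^sup>2 + z * y + y\<^sup>2)"
  have diff: "reduced_foc a r z - reduced_foc a r y = (z - y) * ?d / 2"
    unfolding reduced_foc_def slope2_def reply1_def
    by (simp add: field_simps power2_eq_square power3_eq_cube)
  have "0 < ?d"
  proof -
    have "z\<^sup>2 \<le> a\<^sup>2" "y\<^sup>2 \<le> a\<^sup>2" "z * y \<le> a\<^sup>2"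
      using yz by (simp_all add: power2_eq_square mult_mono)
    moreover have "(1 + r) * (z + y) \<le> (2 - a) * (2 * a)"
      using yz r by (intro mult_mono) auto
    moreover have "a\<^sup>2 \<le> 4 / 5 * a"
      using a_gt a_le by (simp add: power2_eq_square mult_right_mono)
    moreover have "(2 - a) * (2 * a) = 4 * a - 2 * a\<^sup>2"
      by (simp add: algebra_simps power2_eq_square)
    ultimately show ?thesis
      using r a_gt a_le by linarith
  qed
  then have "0 < reduced_foc a r z - reduced_foc a r y"
    using yz unfolding diff by simp
  then show ?thesis by simp
qed

lemma ex_reduced_foc_eq_0:
  assumes "0 \<le> r" "r \<le> 1 - a"
  shows "\<exists>y\<ge>0. y \<le> a \<and> reduced_foc a r y = 0"
proof (rule IVT')
  show "continuous_on {0..a} (reduced_foc a r)"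
    unfolding reduced_foc_def slope2_def reply1_def by (intro continuous_intros) auto
  show "reduced_foc a r 0 \<le> 0" "0 \<le> reduced_foc a r a"
    using assms a_gt slope2_at_0_neg slope2_at_a_pos reply1_pos
    unfolding reduced_foc_def by (simp_all add: less_imp_le)
qed (use a_gt in simp)

lemma equilibrium_props:
  assumes "0 \<le> r" "r \<le> 1 - a"
  shows "price1_eq a r = reply1 a r (price2_eq a r)"
    and "price2_eq a r \<in> {0..a}"
    and "reduced_foc a r (price2_eq a r) = 0"
proof -
  obtain y where y: "0 \<le> y" "y \<le> a" "reduced_foc a r y = 0"
    using ex_reduced_foc_eq_0[OF assms] by blast
  have "is_equilibrium a r (equilibrium a r)"
    unfolding equilibrium_def
  proof (rule theI)
    show "is_equilibrium a r (reply1 a r y, y)"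
      using y assms is_equilibrium_iff by simp
    fix p assume "is_equilibrium a r p"
    moreover obtain u v where p: "p = (u, v)"
      by fastforce
    ultimately have uv: "u = reply1 a r v" "0 \<le> v" "v \<le> a" "reduced_foc a r v = 0"
      using assms is_equilibrium_iff by auto
    then have "v = y"
      using y reduced_foc_strict_mono[OF assms] by (metis linorder_neqE order_less_irrefl)
    then show "p = (reply1 a r y, y)"
      using p uv by simp
  qed
  then have "is_equilibrium a r (price1_eq a r, price2_eq a r)"
    by (simp add: price1_eq_def price2_eq_def)
  then show "price1_eq a r = reply1 a r (price2_eq a r)" "price2_eq a r \<in> {0..a}"
    "reduced_foc a r (price2_eq a r) = 0"
    using is_equilibrium_iff[OF assms] by auto
qed

section \<open>Size and monotonicity of Firm 2's equilibrium price\<close>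

text \<open>Since the cubic increases in the price, its sign at a trial price locates the root, so
  price comparisons become polynomial inequalities.\<close>

lemma price2_eq_le_iff:
  assumes "0 \<le> r" "r \<le> 1 - a" "0 \<le> y" "y \<le> a"
  shows "price2_eq a r \<le> y \<longleftrightarrow> 0 \<le> reduced_foc a r y"
proof -
  have "0 \<le> price2_eq a r" "price2_eq a r \<le> a" and 0: "reduced_foc a r (price2_eq a r) = 0"
    using equilibrium_props[OF assms(1,2)] by auto
  then show ?thesis
    using reduced_foc_strict_mono[OF assms(1,2), of "price2_eq a r" y]
      reduced_foc_strict_mono[OF assms(1,2), of y "price2_eq a r"] assms(3,4)
    by (cases "price2_eq a r" y rule: linorder_cases) auto
qed

text \<open>At zero return cost the cubic depends on \<open>a\<close> only through
  \<open>a - a\<^sup>2 / 2\<close>; \<open>41 / 100\<close> lies just above its root in the extreme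
  case \<open>a = 4 / 5\<close>.\<close>

lemma price2_eq_0_le: "price2_eq a 0 \<le> 41 / 100"
proof -
  have "a - a\<^sup>2 / 2 \<le> 12 / 25"
    using mult_nonneg_nonneg[of "4 / 5 - a" "6 / 5 - a"] a_le
    by (simp add: algebra_simps power2_eq_square)
  then have "0 \<le> reduced_foc a 0 (41 / 100)"
    unfolding reduced_foc_def slope2_def reply1_def
    by (simp add: field_simps power2_eq_square)
  then show ?thesis
    using price2_eq_le_iff[of 0 "41 / 100"] a_gt a_le by simp
qed

abbreviation decreasing_up_to :: "real set" where
  "decreasing_up_to \<equiv> {\<rho> \<in> {0..1 - a}.
     strict_antimono_on {0..\<rho>} (price1_eq a) \<and> strict_antimono_on {0..\<rho>} (price2_eq a)}"

lemma decreasing_up_to_nonempty: "decreasing_up_to \<noteq> {}"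
proof -
  have "0 \<in> decreasing_up_to"
    using a_le by (simp add: monotone_on_def)
  then show ?thesis by blast
qed

lemma r_hat_le: "r_hat a \<le> 1 - a"
  unfolding r_hat_def using decreasing_up_to_nonempty by (intro cSup_least) auto

text \<open>At \<open>r' = r_hat a\<close> itself the inequality is a limit, as the supremum need not be attained.\<close>

lemma price2_eq_antimono:
  assumes "0 \<le> r" "r < r'" "r' \<le> r_hat a"
  shows "price2_eq a r' \<le> price2_eq a r"
proof -
  let ?y = "price2_eq a r"
  have y: "0 \<le> ?y" "?y \<le> a"
    using equilibrium_props[of r] assms r_hat_le by auto
  have below: "0 \<le> reduced_foc a t ?y" if t: "r < t" "t < r'" for t
  proof -
    have "t < Sup decreasing_up_to"
      using t assms by (simp add: r_hat_def)
    then have "\<exists>\<rho>\<in>decreasing_up_to. t < \<rho>"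
      by (rule less_cSupD[OF decreasing_up_to_nonempty])
    then obtain \<rho> where \<rho>: "\<rho> \<in> decreasing_up_to" "t < \<rho>"
      by (rule bexE)
    then have "strict_antimono_on {0..\<rho>} (price2_eq a)" "\<rho> \<le> 1 - a"
      by simp_all
    moreover have "r \<in> {0..\<rho>}" "t \<in> {0..\<rho>}"
      using \<open>t < \<rho>\<close> t assms(1) by simp_all
    ultimately have "price2_eq a t < ?y"
      using t(1) unfolding monotone_on_def by blast
    then show ?thesis
      using price2_eq_le_iff[of t ?y] y t assms(1) \<open>t < \<rho>\<close> \<open>\<rho> \<le> 1 - a\<close> by simp
  qed
  \<comment> \<open>The limit is taken in the cost argument of the cubic, with the price held at
    \<open>?y\<close>.\<close>
  have "((\<lambda>t. reduced_foc a t ?y) \<longlongrightarrow> reduced_foc a r' ?y) (at_left r')"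
    unfolding reduced_foc_def slope2_def reply1_def by (intro tendsto_intros) auto
  moreover have "\<forall>\<^sub>F t in at_left r'. 0 \<le> reduced_foc a t ?y"
    using eventually_at_left_field assms(2) below by blast
  ultimately have "0 \<le> reduced_foc a r' ?y"
    by (intro tendsto_lowerbound) auto
  then show ?thesis
    using price2_eq_le_iff[of r' ?y] y assms r_hat_le by simp
qed

section \<open>Monotonicity of the profit advantage\<close>

text \<open>
  The derivative with respect to \<open>m\<close> of the advantage of Firm 1 at \<open>(reply1 a m y, y)\<close>, for fixed
  \<open>y\<close>, is negative. It increases with \<open>m\<close> and is convex in \<open>a\<close>, whence the chord bound on \<open>a\<^sup>2\<close>.
\<close>

lemma marginal_advantage_neg:
  assumes "m \<le> 1 - a" "0 \<le> y" "y \<le> 41 / 100"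
  shows "reply1 a m y * (1 + y) + m * (1 - y / 2) - 1 + a\<^sup>2 / 2 + y / 2 - y\<^sup>2 < 0"
proof -
  \<comment> \<open>\<open>b\<close> collects the terms in \<open>m\<close>, \<open>c / 4\<close>
    those in \<open>a\<^sup>2\<close>. As \<open>y < 1 / 2\<close>, the worst case for
    \<open>b\<close> is \<open>m = 1 - a\<close>.\<close>
  define b c where "b = m * (1 / 2 - y)" and "c = a\<^sup>2 * (3 + y)"
  have "b \<le> (1 - a) * (1 / 2 - y)"
    unfolding b_def using assms by (intro mult_right_mono) auto
  also have "\<dots> = 1 / 2 - y - a / 2 + a * y"
    by (simp add: field_simps)
  finally have b: "b \<le> 1 / 2 - y - a / 2 + a * y" .
  have "(a - 1 / 2) * (4 / 5 - a) = 13 / 10 * a - 2 / 5 - a\<^sup>2"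
    by (simp add: field_simps power2_eq_square)
  then have "a\<^sup>2 \<le> 13 / 10 * a - 2 / 5"
    using mult_nonneg_nonneg[of "a - 1 / 2" "4 / 5 - a"] a_gt a_le by linarith
  then have "c \<le> (13 / 10 * a - 2 / 5) * (3 + y)"
    unfolding c_def using assms by (intro mult_right_mono) auto
  also have "\<dots> = 39 / 10 * a + 13 / 10 * (a * y) - 6 / 5 - 2 / 5 * y"
    by (simp add: field_simps)
  finally have c: "c \<le> 39 / 10 * a + 13 / 10 * (a * y) - 6 / 5 - 2 / 5 * y" .
  have ay: "a * y \<le> 4 / 5 * y"
    using assms a_le by (intro mult_right_mono) auto
  \<comment> \<open>This is what remains after inserting the bounds and \<open>a > 1 / 2\<close>,
    with \<open>5 / 16 = 3 / 10 + 1 / 80\<close>. The proof bounds \<open>y\<^sup>2\<close> below by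
    its tangent at \<open>41 / 100\<close>.\<close>
  have cubic: "53 / 50 * y - 3 / 4 * y\<^sup>2 - y ^ 3 / 4 < 5 / 16"
  proof -
    have "(y - 41 / 100)\<^sup>2 = y\<^sup>2 - 41 / 50 * y + 1681 / 10000"
      by (simp add: field_simps power2_eq_square)
    moreover have "0 \<le> y ^ 3"
      using assms by simp
    ultimately show ?thesis
      using assms zero_le_power2[of "y - 41 / 100"] by linarith
  qed
  have "reply1 a m y * (1 + y) + m * (1 - y / 2) - 1 + a\<^sup>2 / 2 + y / 2 - y\<^sup>2
      = b + c / 4 - 1 / 2 - a / 2 - a * y / 2 + 3 / 2 * y - 3 / 4 * y\<^sup>2 - y ^ 3 / 4"
    unfolding reply1_def b_def c_def by (simp add: field_simps power2_eq_square power3_eq_cube)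
  also have "\<dots> < 0"
    using b c ay cubic a_gt by linarith
  finally show ?thesis .
qed

text \<open>For fixed \<open>y\<close> the advantage is quadratic in the return cost, so its
  increment is the step times the derivative at the midpoint.\<close>

lemma advantage_at_reply1_diff:
  "(profit1 a r' (reply1 a r' y) y - profit2 a r' (reply1 a r' y) y)
     - (profit1 a r (reply1 a r y) y - profit2 a r (reply1 a r y) y)
   = (r' - r) * (reply1 a ((r + r') / 2) y * (1 + y) + (r + r') / 2 * (1 - y / 2)
       - 1 + a\<^sup>2 / 2 + y / 2 - y\<^sup>2)"
proof -
  define x d where "x = reply1 a r y" and "d = r' - r"
  have d: "r' = r + d"
    by (simp add: d_def)
  have x: "reply1 a r' y = x - d / 2" "reply1 a ((r + r') / 2) y = x - d / 4"
    unfolding x_def d_def reply1_def by (simp_all add: field_simps)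
  show ?thesis
    unfolding profit1_reply1
    unfolding x x_def[symmetric]
    unfolding d profit2_def demand1_no_search_def demand2_fresh_def demand2_comparison_def
    by (simp add: field_simps power2_eq_square)
qed

lemma advantage_strict_antimono:
  assumes r: "0 \<le> r" "r < r'" "r' \<le> r_hat a"
  shows "profit1_eq a r' - profit2_eq a r' < profit1_eq a r - profit2_eq a r"
proof -
  define y y' where "y = price2_eq a r" and "y' = price2_eq a r'"
  define x x' z where "x = reply1 a r y" and "x' = reply1 a r' y'" and "z = reply1 a r' y"
  have r': "r' \<le> 1 - a"
    using r r_hat_le by linarith
  have y: "0 \<le> y" "y \<le> a" and x: "price1_eq a r = x"
    using equilibrium_props[of r] r r' by (auto simp: y_def x_def)
  have y': "0 \<le> y'" "y' \<le> a" and x': "price1_eq a r' = x'" and foc: "slope2 a r' x' y' = 0"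
    using equilibrium_props[of r'] r r' by (auto simp: y'_def x'_def reduced_foc_def)
  have "y' \<le> y"
    using price2_eq_antimono[OF r] by (simp add: y_def y'_def)
  have "y \<le> 41 / 100"
    using price2_eq_antimono[of 0 r] price2_eq_0_le r by (cases "r = 0") (auto simp: y_def)
  have "0 < x'" "0 < z"
    using reply1_pos[of r'] y y' r' by (simp_all add: x'_def z_def)
  \<comment> \<open>Firm 1's best reply increases with Firm 2's price as long as that price is below
    1.\<close>
  have "x' \<le> z"
  proof -
    have "z - x' = (y - y') * (2 - y - y') / 4"
      unfolding z_def x'_def reply1_def by (simp add: field_simps power2_eq_square)
    moreover have "0 \<le> (y - y') * (2 - y - y')"
      using \<open>y' \<le> y\<close> \<open>y \<le> 41 / 100\<close> by simp
    ultimately show ?thesis by simp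
  qed
  have "profit2 a r' x' y \<le> profit2 a r' x' y'"
    using profit2_less_of_slope2_eq_0[of r' x' y' y] r r' \<open>0 < x'\<close> y y' foc
    by (cases "y = y'") auto
  \<comment> \<open>The squares give Firm 1's maximal profits against \<open>y'\<close> and
    \<open>y\<close>, so its gain factors through \<open>z - x'\<close>, as does Firm 2's.\<close>
  moreover have "(x' + r')\<^sup>2 - r' - profit2 a r' x' y \<le> (z + r')\<^sup>2 - r' - profit2 a r' z y"
  proof -
    have "y * (1 - y - r') \<le> z + x' + 2 * r'"
    proof -
      \<comment> \<open>The right side is positive because \<open>y < 1 / 2\<close>.\<close>
      have "z + x' + 2 * r' - y
          = (1 - a)\<^sup>2 / 2 + 1 / 2 - y + r' + y * (2 - y) / 4 + y' * (2 - y') / 4"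
        unfolding z_def x'_def reply1_def by (simp add: field_simps power2_eq_square)
      moreover have "0 \<le> y * (2 - y)" "0 \<le> y' * (2 - y')" "0 \<le> y * y" "0 \<le> y * r'"
        using y y' a_le r by simp_all
      moreover have "y * (1 - y - r') = y - y * y - y * r'"
        by (simp add: algebra_simps)
      ultimately show ?thesis
        using \<open>y \<le> 41 / 100\<close> r zero_le_power2[of "1 - a"] by linarith
    qed
    then have "0 \<le> (z - x') * (z + x' + 2 * r' - y * (1 - y - r'))"
      using \<open>x' \<le> z\<close> by simp
    also have "\<dots> = (z + r')\<^sup>2 - (x' + r')\<^sup>2 - (z - x') * (y * (1 - y - r'))"
      by (simp add: algebra_simps power2_eq_square)
    finally show ?thesis
      using profit2_diff_price1[of a r' z y x'] by simp
  qed
  moreover have "(z + r')\<^sup>2 - r' - profit2 a r' z y < (x + r)\<^sup>2 - r - profit2 a r x y"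
  proof -
    have "(r' - r) * (reply1 a ((r + r') / 2) y * (1 + y) + (r + r') / 2 * (1 - y / 2)
       - 1 + a\<^sup>2 / 2 + y / 2 - y\<^sup>2) < 0"
      using marginal_advantage_neg[of "(r + r') / 2" y] r r' y \<open>y \<le> 41 / 100\<close>
      by (simp add: mult_less_0_iff)
    then show ?thesis
      using advantage_at_reply1_diff[of r' y r] by (simp add: profit1_reply1 x_def z_def)
  qed
  ultimately show ?thesis
    unfolding profit1_eq_def profit2_eq_def x x' y_def[symmetric] y'_def[symmetric]
    by (simp add: x_def x'_def profit1_reply1)
qed

end

theorem mainTheorem16:
  fixes s a :: real
  assumes "s \<in> {1/50..<1/8}"
    and "a = 1 - sqrt (2 * s)"
  shows "strict_antimono_on {0..r_hat a} (\<lambda>r. profit1_eq a r - profit2_eq a r)"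
proof -
  have "1 / 5 \<le> sqrt (2 * s)"
    using assms(1) by (intro real_le_rsqrt) (auto simp: power2_eq_square)
  moreover have "sqrt (2 * s) < 1 / 2"
    using assms(1) by (intro real_less_lsqrt) (auto simp: power2_eq_square)
  ultimately interpret market a
    by unfold_locales (use assms(2) in auto)
  show ?thesis
    using advantage_strict_antimono by (auto simp: monotone_on_def)
qed

end
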